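(* Let $\Phi:\mathsf X\to\mathsf B$ be a fibration of categories which has a left adjoint $\mathsf D:\mathsf B\to\mathsf X$. Suppose that $\mathsf X$ admits pushouts. Let $v:K\to J$ be a morphism in $\mathsf B$, and let $Z\in\mathsf X_K$. Then a cocartesian lifting $\psi:Z\to Y$ of $v$ is given precisely by the pushout in $\mathsf X$: $$\begin{array}{ccc}\mathsf D(K)&\xrightarrow{\ \mathsf D(v)\ }&\mathsf D(J)\\ {\scriptstyle\varepsilon_K}\downarrow&&\downarrow{\scriptstyle\varepsilon_J}\\ Z&\xrightarrow{\ \ \psi\ \ }&Y\end{array}$$
   Context: For a functor $\Phi:\mathsf X\to\mathsf B$, a morphism $\varphi:Y\to X$ in $\mathsf X$ with $\Phi(\varphi)=u:J\to I$ is cartesian if for all $v:K\to J$ in $\mathsf B$ and all $\theta:Z\to X$ with $\Phi(\theta)=uv$ there is a unique $\psi:Z\to Y$ with $\Phi(\psi)=v$ and $\theta=\varphi\psi$. $\Phi$ is a fibration if for all $u:J\to I$ in $\mathsf B$ and all $X$ with $\Phi(X)=I$ there is a cartesian morphism $Y\to X$ over $u$. A morphism $\psi:Z\to Y$ with $\Phi(\psi)=v:K\to J$ is cocartesian if for all $u:J\to I$ in $\mathsf B$ and all $\theta:Z\to X$ with $\Phi(\theta)=uv$ there is a unique $\varphi:Y\to X$ with $\Phi(\varphi)=u$ and $\theta=\varphi\psi$; it is then called a cocartesian lifting of $Z$ along $v$. The fibre $\mathsf X_I$ consists of the objects over $I$ and the morphisms over $\mathrm{id}_I$. For each object $K$ of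 $\mathsf B$, $\mathsf D(K)$ is initial in the fibre $\mathsf X_K$, and for any $u:K\to J$ in $\mathsf B$ and $X\in\mathsf X_J$ there is a unique morphism $\mathsf D(K)\to X$ over $u$. The morphisms $\varepsilon_K:\mathsf D(K)\to Z$ and $\varepsilon_J:\mathsf D(J)\to Y$ are the unique morphisms over $\mathrm{id}_K$ and $\mathrm{id}_J$ respectively. *)

theory Defs
  imports Main
begin

text \<open>Categories have carrier sets of objects and arrows; composition \<open>g \<cdot> f\<close> (first \<open>f\<close>, then
  \<open>g\<close>) is only meaningful when \<open>Cod f = Dom g\<close>.\<close>

record ('o, 'm) cat =
  Obj :: "'o set"
  Arr :: "'m set"
  Dom :: "'m \<Rightarrow> 'o"
  Cod :: "'m \<Rightarrow> 'o"
  Idt :: "'o \<Rightarrow> 'm"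
  Cmp :: "'m \<Rightarrow> 'm \<Rightarrow> 'm"  (infixl \<open>\<cdot>\<index>\<close> 70)

definition hom :: "('o, 'm) cat \<Rightarrow> 'o \<Rightarrow> 'o \<Rightarrow> 'm set" where
  "hom C a b = {f \<in> Arr C. Dom C f = a \<and> Cod C f = b}"

locale category =
  fixes C :: "('o, 'm) cat" (structure)
  assumes dom_closed: "f \<in> Arr C \<Longrightarrow> Dom C f \<in> Obj C"
    and cod_closed: "f \<in> Arr C \<Longrightarrow> Cod C f \<in> Obj C"
    and id_hom: "a \<in> Obj C \<Longrightarrow> Idt C a \<in> hom C a a"
    and comp_hom: "\<lbrakk>f \<in> hom C a b; g \<in> hom C b c\<rbrakk> \<Longrightarrow> g \<cdot> f \<in> hom C a c"
    and comp_id_right: "f \<in> hom C a b \<Longrightarrow> f \<cdot> Idt C a = f"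
    and comp_id_left: "f \<in> hom C a b \<Longrightarrow> Idt C b \<cdot> f = f"
    and comp_assoc: "\<lbrakk>f \<in> hom C a b; g \<in> hom C b c; h \<in> hom C c d\<rbrakk> \<Longrightarrow>
      h \<cdot> (g \<cdot> f) = (h \<cdot> g) \<cdot> f"

record ('o, 'm, 'p, 'n) func =
  fobj :: "'o \<Rightarrow> 'p"
  farr :: "'m \<Rightarrow> 'n"

locale is_functor = A: category A + B: category B
  for A :: "('o, 'm) cat" and B :: "('p, 'n) cat" and F :: "('o, 'm, 'p, 'n) func" +
  assumes fobj_closed: "a \<in> Obj A \<Longrightarrow> fobj F a \<in> Obj B"
    and farr_hom: "f \<in> hom A a b \<Longrightarrow> farr F f \<in> hom B (fobj F a) (fobj F b)"
    and farr_id: "a \<in> Obj A \<Longrightarrow> farr F (Idt A a) = Idt B (fobj F a)"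
    and farr_comp: "\<lbrakk>f \<in> hom A a b; g \<in> hom A b c\<rbrakk> \<Longrightarrow>
      farr F (g \<cdot>\<^bsub>A\<^esub> f) = farr F g \<cdot>\<^bsub>B\<^esub> farr F f"

text \<open>\<open>L : B \<rightarrow> A\<close> is left adjoint to \<open>R : A \<rightarrow> B\<close> with unit \<open>\<eta> : 1 \<rightarrow> R L\<close>.\<close>

definition left_adjoint ::
  "('o, 'm) cat \<Rightarrow> ('p, 'n) cat \<Rightarrow> ('p, 'n, 'o, 'm) func \<Rightarrow> ('o, 'm, 'p, 'n) func \<Rightarrow> ('p \<Rightarrow> 'n) \<Rightarrow> bool"
where
  "left_adjoint A B L R \<eta> \<longleftrightarrow>
     is_functor B A L \<and> is_functor A B R \<and>
     (\<forall>b \<in> Obj B. \<eta> b \<in> hom B b (fobj R (fobj L b))) \<and>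
     (\<forall>b c. \<forall>v \<in> hom B b c. \<eta> c \<cdot>\<^bsub>B\<^esub> v = farr R (farr L v) \<cdot>\<^bsub>B\<^esub> \<eta> b) \<and>
     (\<forall>b \<in> Obj B. \<forall>a \<in> Obj A. \<forall>f \<in> hom B b (fobj R a).
        \<exists>!g. g \<in> hom A (fobj L b) a \<and> farr R g \<cdot>\<^bsub>B\<^esub> \<eta> b = f)"

definition is_pushout :: "('o, 'm) cat \<Rightarrow> 'm \<Rightarrow> 'm \<Rightarrow> 'm \<Rightarrow> 'm \<Rightarrow> bool" where
  \<comment> \<open>\<open>p\<close> is opposite to \<open>g\<close> and \<open>q\<close> is opposite to \<open>f\<close>: the square is \<open>p f = q g\<close>.\<close>
  "is_pushout C f g p q \<longleftrightarrow>
     f \<in> Arr C \<and> g \<in> Arr C \<and> p \<in> Arr C \<and> q \<in> Arr C \<and>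
     Dom C f = Dom C g \<and> Dom C p = Cod C f \<and> Dom C q = Cod C g \<and> Cod C p = Cod C q \<and>
     p \<cdot>\<^bsub>C\<^esub> f = q \<cdot>\<^bsub>C\<^esub> g \<and>
     (\<forall>x. \<forall>s \<in> hom C (Cod C f) x. \<forall>t \<in> hom C (Cod C g) x. s \<cdot>\<^bsub>C\<^esub> f = t \<cdot>\<^bsub>C\<^esub> g \<longrightarrow>
        (\<exists>!h. h \<in> hom C (Cod C p) x \<and> h \<cdot>\<^bsub>C\<^esub> p = s \<and> h \<cdot>\<^bsub>C\<^esub> q = t))"

definition has_pushouts :: "('o, 'm) cat \<Rightarrow> bool" where
  "has_pushouts C \<longleftrightarrow>
     (\<forall>f \<in> Arr C. \<forall>g \<in> Arr C. Dom C f = Dom C g \<longrightarrow> (\<exists>p q. is_pushout C f g p q))"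

context
  fixes X :: "('o, 'm) cat" and B :: "('p, 'n) cat" and \<Phi> :: "('o, 'm, 'p, 'n) func"
begin

definition cartesian :: "'m \<Rightarrow> bool" where
  "cartesian \<phi> \<longleftrightarrow> \<phi> \<in> Arr X \<and>
     (\<forall>v \<in> Arr B. \<forall>\<theta> \<in> Arr X.
        Cod B v = fobj \<Phi> (Dom X \<phi>) \<and> Cod X \<theta> = Cod X \<phi> \<and>
        Dom B v = fobj \<Phi> (Dom X \<theta>) \<and> farr \<Phi> \<theta> = farr \<Phi> \<phi> \<cdot>\<^bsub>B\<^esub> v \<longrightarrow>
        (\<exists>!\<psi>. \<psi> \<in> hom X (Dom X \<theta>) (Dom X \<phi>) \<and> farr \<Phi> \<psi> = v \<and> \<theta> = \<phi> \<cdot>\<^bsub>X\<^esub> \<psi>))"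

definition fibration :: bool where
  "fibration \<longleftrightarrow> is_functor X B \<Phi> \<and>
     (\<forall>u \<in> Arr B. \<forall>x \<in> Obj X. fobj \<Phi> x = Cod B u \<longrightarrow>
        (\<exists>\<phi>. cartesian \<phi> \<and> Cod X \<phi> = x \<and> farr \<Phi> \<phi> = u))"

definition cocartesian :: "'m \<Rightarrow> bool" where
  "cocartesian \<psi> \<longleftrightarrow> \<psi> \<in> Arr X \<and>
     (\<forall>u \<in> Arr B. \<forall>\<theta> \<in> Arr X.
        Dom B u = fobj \<Phi> (Cod X \<psi>) \<and> Dom X \<theta> = Dom X \<psi> \<and>
        Cod B u = fobj \<Phi> (Cod X \<theta>) \<and> farr \<Phi> \<theta> = u \<cdot>\<^bsub>B\<^esub> farr \<Phi> \<psi> \<longrightarrow>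
        (\<exists>!\<phi>. \<phi> \<in> hom X (Cod X \<psi>) (Cod X \<theta>) \<and> farr \<Phi> \<phi> = u \<and> \<theta> = \<phi> \<cdot>\<^bsub>X\<^esub> \<psi>))"

definition cocartesian_lifting :: "'o \<Rightarrow> 'n \<Rightarrow> 'm \<Rightarrow> bool" where
  "cocartesian_lifting z v \<psi> \<longleftrightarrow> cocartesian \<psi> \<and> Dom X \<psi> = z \<and> farr \<Phi> \<psi> = v"

definition fibre :: "'p \<Rightarrow> ('o, 'm) cat" where
  "fibre I = X\<lparr>Obj := {x \<in> Obj X. fobj \<Phi> x = I},
               Arr := {f \<in> Arr X. farr \<Phi> f = Idt B I}\<rparr>"

text \<open>When \<open>D\<close> is left adjoint to \<open>\<Phi>\<close> with identity unit, \<open>fobj D I\<close> is initial in the fibre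
  over \<open>I\<close> (\<open>fibre_initial\<close> below), so the description is proper for \<open>x\<close> over \<open>I\<close>.\<close>

definition eps :: "('p, 'n, 'o, 'm) func \<Rightarrow> 'p \<Rightarrow> 'o \<Rightarrow> 'm" where
  "eps D I x = (THE e. e \<in> hom (fibre I) (fobj D I) x)"

end

lemma unique_over:
  assumes adj: "left_adjoint X B D \<Phi> \<eta>"
    and unit: "\<And>I. I \<in> Obj B \<Longrightarrow> \<eta> I = Idt B I"
    and u: "u \<in> hom B I (fobj \<Phi> x)" and x: "x \<in> Obj X"
  shows "\<exists>!f. f \<in> hom X (fobj D I) x \<and> farr \<Phi> f = u"
proof -
  interpret P: is_functor X B \<Phi> using adj by (simp add: left_adjoint_def)
  have I: "I \<in> Obj B" using u P.B.dom_closed by (auto simp: hom_def)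
  have ex: "\<exists>!g. g \<in> hom X (fobj D I) x \<and> farr \<Phi> g \<cdot>\<^bsub>B\<^esub> \<eta> I = u"
    using adj I x u by (simp add: left_adjoint_def)
  have "\<eta> I \<in> hom B I (fobj \<Phi> (fobj D I))" using adj I by (simp add: left_adjoint_def)
  then have obj: "fobj \<Phi> (fobj D I) = I"
    using unit[OF I] P.B.id_hom[OF I] by (simp add: hom_def)
  have "farr \<Phi> g \<cdot>\<^bsub>B\<^esub> \<eta> I = farr \<Phi> g" if "g \<in> hom X (fobj D I) x" for g
    using P.farr_hom[OF that] P.B.comp_id_right unit[OF I] obj by metis
  with ex show ?thesis by (metis (no_types, lifting))
qed

lemma fibre_initial:
  assumes adj: "left_adjoint X B D \<Phi> \<eta>"
    and unit: "\<And>I. I \<in> Obj B \<Longrightarrow> \<eta> I = Idt B I"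
    and x: "x \<in> Obj (fibre X B \<Phi> I)" and I: "I \<in> Obj B"
  shows "fobj D I \<in> Obj (fibre X B \<Phi> I)"
    and "\<exists>!e. e \<in> hom (fibre X B \<Phi> I) (fobj D I) x"
proof -
  interpret P: is_functor X B \<Phi> using adj by (simp add: left_adjoint_def)
  interpret D: is_functor B X D using adj by (simp add: left_adjoint_def)
  have "\<eta> I \<in> hom B I (fobj \<Phi> (fobj D I))" using adj I by (simp add: left_adjoint_def)
  then show "fobj D I \<in> Obj (fibre X B \<Phi> I)"
    using unit[OF I] P.B.id_hom[OF I] D.fobj_closed[OF I] by (simp add: hom_def fibre_def)
  have "Idt B I \<in> hom B I (fobj \<Phi> x)" "x \<in> Obj X"
    using x P.B.id_hom[OF I] by (auto simp: fibre_def)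
  from unique_over[OF adj unit this]
  show "\<exists>!e. e \<in> hom (fibre X B \<Phi> I) (fobj D I) x"
    by (simp add: hom_def fibre_def conj_ac)
qed

end

theory Submission
  imports Defs
begin

text \<open>Every arrow out of \<open>D I\<close> is determined by its image in the base, so the squares in question
  commute as soon as their images do, and a cocone on the span \<open>D J \<leftarrow> D K \<rightarrow> Z\<close> amounts to an arrow
  out of \<open>Z\<close> together with a factorisation of its image through \<open>v\<close>. This identifies the two
  universal properties. A pushout in the total category need not lie over \<open>J\<close>, but pulling it back
  along the image of its leg out of \<open>D J\<close> gives a cocone over \<open>J\<close>; the comparison arrow shows that
  image to be invertible, so the pulled back cocone is again a pushout.\<close>

section \<open>Pushouts in a category and their transport along isomorphisms\<close>

lemma homD:
  assumes "f \<in> hom C a b"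
  shows "f \<in> Arr C" "Dom C f = a" "Cod C f = b"
  using assms by (auto simp: hom_def)

lemma pushout_factor:
  assumes "is_pushout C f g p q" and "f \<in> hom C a b" and "g \<in> hom C a c" and "p \<in> hom C b w"
    and "s \<in> hom C b x" and "t \<in> hom C c x" and "s \<cdot>\<^bsub>C\<^esub> f = t \<cdot>\<^bsub>C\<^esub> g"
  shows "\<exists>!h. h \<in> hom C w x \<and> h \<cdot>\<^bsub>C\<^esub> p = s \<and> h \<cdot>\<^bsub>C\<^esub> q = t"
proof -
  have "Cod C f = b" "Cod C g = c" "Cod C p = w" using assms(2-4) by (auto simp: hom_def)
  with assms(1,5-7) show ?thesis unfolding is_pushout_def by blast
qed

context category
begin

text \<open>Sending \<open>m\<close> to \<open>m \<cdot> k\<close> and \<open>l\<close> to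
  \<open>l \<cdot> h\<close> gives mutually inverse bijections between the arrows out of the two
  vertices, so factorisations through the old and the new cocone correspond.\<close>

lemma pushout_iso:
  assumes po: "is_pushout C f g p q"
    and h: "h \<in> hom C (Cod C p) y" and k: "k \<in> hom C y (Cod C p)"
    and kh: "k \<cdot> h = Idt C (Cod C p)" and hk: "h \<cdot> k = Idt C y"
  shows "is_pushout C f g (h \<cdot> p) (h \<cdot> q)"
proof -
  let ?w = "Cod C p"
  have f: "f \<in> hom C (Dom C g) (Cod C f)" and g: "g \<in> hom C (Dom C g) (Cod C g)"
    and p: "p \<in> hom C (Cod C f) ?w" and q: "q \<in> hom C (Cod C g) ?w"
    and comm: "p \<cdot> f = q \<cdot> g"
    using po by (auto simp: is_pushout_def hom_def)
  have hp: "h \<cdot> p \<in> hom C (Cod C f) y" and hq: "h \<cdot> q \<in> hom C (Cod C g) y"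
    using comp_hom p q h by blast+
  have "\<exists>!l. l \<in> hom C y x \<and> l \<cdot> (h \<cdot> p) = s \<and> l \<cdot> (h \<cdot> q) = t"
    if s: "s \<in> hom C (Cod C f) x" and t: "t \<in> hom C (Cod C g) x" and st: "s \<cdot> f = t \<cdot> g" for x s t
  proof -
    have ex: "\<exists>!m. m \<in> hom C ?w x \<and> m \<cdot> p = s \<and> m \<cdot> q = t"
      using pushout_factor[OF po f g p s t st] .
    then obtain m where m: "m \<in> hom C ?w x" "m \<cdot> p = s" "m \<cdot> q = t" by blast
    have mkh: "(m \<cdot> k) \<cdot> h = m"
      using comp_assoc[OF h k m(1)] comp_id_right[OF m(1)] kh by simp
    have mk: "m \<cdot> k \<in> hom C y x" using comp_hom[OF k m(1)] .
    show ?thesis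
    proof (rule ex1I[of _ "m \<cdot> k"])
      show "m \<cdot> k \<in> hom C y x \<and> m \<cdot> k \<cdot> (h \<cdot> p) = s \<and> m \<cdot> k \<cdot> (h \<cdot> q) = t"
        using mk comp_assoc[OF p h mk] comp_assoc[OF q h mk] mkh m by simp
    next
      fix l assume l: "l \<in> hom C y x \<and> l \<cdot> (h \<cdot> p) = s \<and> l \<cdot> (h \<cdot> q) = t"
      then have ly: "l \<in> hom C y x" by blast
      have "l \<cdot> h \<in> hom C ?w x" "(l \<cdot> h) \<cdot> p = s" "(l \<cdot> h) \<cdot> q = t"
        using l comp_hom[OF h ly] comp_assoc[OF p h ly] comp_assoc[OF q h ly] by auto
      then have "l \<cdot> h = m" using ex m by blast
      then show "l = m \<cdot> k"
        using comp_assoc[OF k h ly] comp_id_right[OF ly] hk by simp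
    qed
  qed
  moreover have "(h \<cdot> p) \<cdot> f = (h \<cdot> q) \<cdot> g"
    using comp_assoc[OF f p h] comp_assoc[OF g q h] comm by simp
  ultimately show ?thesis
    using homD[OF f] homD[OF g] homD[OF hp] homD[OF hq] unfolding is_pushout_def by simp
qed

end

section \<open>Universal properties of cartesian and cocartesian arrows, in terms of
  hom-sets\<close>

lemma cartesian_factor:
  assumes "cartesian X B \<Phi> \<phi>" and \<phi>: "\<phi> \<in> hom X y w" and \<theta>: "\<theta> \<in> hom X z w"
    and "u \<in> hom B (fobj \<Phi> z) (fobj \<Phi> y)" and "farr \<Phi> \<theta> = farr \<Phi> \<phi> \<cdot>\<^bsub>B\<^esub> u"
  shows "\<exists>!\<psi>. \<psi> \<in> hom X z y \<and> farr \<Phi> \<psi> = u \<and> \<theta> = \<phi> \<cdot>\<^bsub>X\<^esub> \<psi>"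
  using assms unfolding cartesian_def hom_def mem_Collect_eq by (elim conjE) (hypsubst, blast)

lemma cocartesian_factor:
  assumes "cocartesian X B \<Phi> \<psi>" and "\<psi> \<in> hom X z y" and "\<theta> \<in> hom X z x"
    and "u \<in> hom B (fobj \<Phi> y) (fobj \<Phi> x)" and "farr \<Phi> \<theta> = u \<cdot>\<^bsub>B\<^esub> farr \<Phi> \<psi>"
  shows "\<exists>!\<phi>. \<phi> \<in> hom X y x \<and> farr \<Phi> \<phi> = u \<and> \<theta> = \<phi> \<cdot>\<^bsub>X\<^esub> \<psi>"
  using assms unfolding cocartesian_def hom_def mem_Collect_eq by (elim conjE) (hypsubst, blast)

section \<open>Adjunctions with identity unit\<close>

locale identity_unit_adjunction =
  fixes X :: "('o, 'm) cat" and B :: "('p, 'n) cat"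
    and \<Phi> :: "('o, 'm, 'p, 'n) func" and D :: "('p, 'n, 'o, 'm) func" and \<eta> :: "'p \<Rightarrow> 'n"
  assumes adj: "left_adjoint X B D \<Phi> \<eta>"
    and unit: "I \<in> Obj B \<Longrightarrow> \<eta> I = Idt B I"
begin

sublocale P: is_functor X B \<Phi> using adj by (simp add: left_adjoint_def)
sublocale L: is_functor B X D using adj by (simp add: left_adjoint_def)

lemma hom_objs: "f \<in> hom X a b \<Longrightarrow> a \<in> Obj X \<and> b \<in> Obj X"
  using P.A.dom_closed P.A.cod_closed by (auto simp: hom_def)

lemma base_hom_objs: "f \<in> hom B a b \<Longrightarrow> a \<in> Obj B \<and> b \<in> Obj B"
  using P.B.dom_closed P.B.cod_closed by (auto simp: hom_def)

text \<open>The unit at \<open>I\<close> ends at \<open>fobj \<Phi> (fobj D I)\<close>, while the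
  identity it equals ends at \<open>I\<close>.\<close>

lemma fobj_D: "I \<in> Obj B \<Longrightarrow> fobj \<Phi> (fobj D I) = I"
  using adj unit P.B.id_hom by (fastforce simp: left_adjoint_def hom_def)

text \<open>This is naturality of the unit at \<open>v\<close>, with identities at both
  ends.\<close>

lemma farr_D:
  assumes v: "v \<in> hom B K J"
  shows "farr \<Phi> (farr D v) = v"
proof -
  have KJ: "K \<in> Obj B" "J \<in> Obj B" using base_hom_objs[OF v] by auto
  have "farr \<Phi> (farr D v) \<in> hom B K J"
    using P.farr_hom[OF L.farr_hom[OF v]] KJ by (simp add: fobj_D)
  moreover have "\<eta> J \<cdot>\<^bsub>B\<^esub> v = farr \<Phi> (farr D v) \<cdot>\<^bsub>B\<^esub> \<eta> K"
    using adj v by (simp add: left_adjoint_def)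
  ultimately show ?thesis
    using KJ v by (simp add: unit P.B.comp_id_left P.B.comp_id_right)
qed

lemma arrow_from_D_exists:
  assumes "u \<in> hom B I (fobj \<Phi> x)" and "x \<in> Obj X"
  obtains f where "f \<in> hom X (fobj D I) x" and "farr \<Phi> f = u"
  using unique_over[OF adj unit assms] by blast

text \<open>The uniqueness half of the adjunction; it reduces equations between arrows out of
  \<open>fobj D I\<close> to equations in the base.\<close>

lemma arrows_from_D_eqI:
  assumes f: "f \<in> hom X (fobj D I) x" and g: "g \<in> hom X (fobj D I) x"
    and I: "I \<in> Obj B" and eq: "farr \<Phi> f = farr \<Phi> g"
  shows "f = g"
proof -
  have "farr \<Phi> g \<in> hom B I (fobj \<Phi> x)" using P.farr_hom[OF g] fobj_D[OF I] by simp
  with unique_over[OF adj unit this] hom_objs[OF f] f g eq show ?thesis by blast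
qed

lemma eps_arrow:
  assumes "I \<in> Obj B" and "x \<in> Obj (fibre X B \<Phi> I)"
  shows "eps X B \<Phi> D I x \<in> hom X (fobj D I) x" and "farr \<Phi> (eps X B \<Phi> D I x) = Idt B I"
proof -
  have "eps X B \<Phi> D I x \<in> hom (fibre X B \<Phi> I) (fobj D I) x"
    unfolding eps_def by (rule theI'[OF fibre_initial(2)[OF adj unit assms(2,1)]])
  then show "eps X B \<Phi> D I x \<in> hom X (fobj D I) x" "farr \<Phi> (eps X B \<Phi> D I x) = Idt B I"
    by (auto simp: hom_def fibre_def)
qed

lemma farr_comp_over_id:
  assumes "e \<in> hom X a b" and "farr \<Phi> e = Idt B (fobj \<Phi> b)" and "f \<in> hom X b c"
  shows "farr \<Phi> (f \<cdot>\<^bsub>X\<^esub> e) = farr \<Phi> f"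
  using assms P.farr_comp P.farr_hom P.B.comp_id_right by metis

section \<open>The square over a fixed arrow of the base\<close>

context
  fixes v K J Z
  assumes v: "v \<in> hom B K J" and Z: "Z \<in> Obj (fibre X B \<Phi> K)"
begin

lemma source_facts:
  shows "K \<in> Obj B" "J \<in> Obj B" "Z \<in> Obj X" "fobj \<Phi> Z = K"
    and "farr D v \<in> hom X (fobj D K) (fobj D J)"
    and "eps X B \<Phi> D K Z \<in> hom X (fobj D K) Z" "farr \<Phi> (eps X B \<Phi> D K Z) = Idt B K"
  using base_hom_objs[OF v] Z eps_arrow[OF _ Z] L.farr_hom[OF v] by (auto simp: fibre_def)

text \<open>Both composites start at \<open>fobj D K\<close>, so they agree as soon as their images
  do; the image of the right one is that of \<open>t\<close>, because \<open>eps\<close> lies over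
  an identity.\<close>

lemma cocone_iff:
  assumes s: "s \<in> hom X (fobj D J) x" and t: "t \<in> hom X Z x"
  shows "s \<cdot>\<^bsub>X\<^esub> farr D v = t \<cdot>\<^bsub>X\<^esub> eps X B \<Phi> D K Z \<longleftrightarrow> farr \<Phi> t = farr \<Phi> s \<cdot>\<^bsub>B\<^esub> v"
proof -
  note S = source_facts
  have l: "s \<cdot>\<^bsub>X\<^esub> farr D v \<in> hom X (fobj D K) x" using P.A.comp_hom[OF S(5) s] .
  have r: "t \<cdot>\<^bsub>X\<^esub> eps X B \<Phi> D K Z \<in> hom X (fobj D K) x" using P.A.comp_hom[OF S(6) t] .
  have "farr \<Phi> (s \<cdot>\<^bsub>X\<^esub> farr D v) = farr \<Phi> s \<cdot>\<^bsub>B\<^esub> v"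
    using P.farr_comp[OF S(5) s] farr_D[OF v] by simp
  moreover have "farr \<Phi> (t \<cdot>\<^bsub>X\<^esub> eps X B \<Phi> D K Z) = farr \<Phi> t"
    using farr_comp_over_id[OF S(6) _ t] S(4,7) by simp
  ultimately show ?thesis using arrows_from_D_eqI[OF l r S(1)] by metis
qed

text \<open>By adjunction, arrows \<open>s\<close> from \<open>fobj D J\<close> to \<open>x\<close>
  are base arrows \<open>u\<close> from \<open>J\<close> to \<open>fobj \<Phi> x\<close>. Cocones
  \<open>(s, t)\<close> become pairs \<open>(u, t)\<close> as in the definition of cocartesian
  arrows, and the same arrows out of \<open>Y\<close> solve both problems.\<close>

lemma cocartesian_lifting_iff_pushout:
  assumes Y: "Y \<in> Obj (fibre X B \<Phi> J)" and \<psi>: "\<psi> \<in> hom X Z Y"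
  shows "cocartesian_lifting X B \<Phi> Z v \<psi> \<longleftrightarrow>
    is_pushout X (farr D v) (eps X B \<Phi> D K Z) (eps X B \<Phi> D J Y) \<psi>"
    (is "?cocart \<longleftrightarrow> ?pushout")
proof -
  note S = source_facts
  let ?e = "eps X B \<Phi> D J Y"
  have YX: "fobj \<Phi> Y = J" using Y by (simp add: fibre_def)
  have e: "?e \<in> hom X (fobj D J) Y" "farr \<Phi> ?e = Idt B J" using eps_arrow[OF S(2) Y] .
  have over: "farr \<Phi> (f \<cdot>\<^bsub>X\<^esub> ?e) = farr \<Phi> f" if "f \<in> hom X Y x" for f x
    using farr_comp_over_id[OF e(1) _ that] e(2) YX by simp
  \<comment> \<open>The pushout condition on the leg \<open>?e\<close> is the cocartesian condition
    on the image.\<close>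
  have through_e: "f \<cdot>\<^bsub>X\<^esub> ?e = s \<longleftrightarrow> farr \<Phi> f = farr \<Phi> s"
    if "f \<in> hom X Y x" "s \<in> hom X (fobj D J) x" for f s x
    using arrows_from_D_eqI[OF P.A.comp_hom[OF e(1) that(1)] that(2) S(2)] over[OF that(1)] by metis
  \<comment> \<open>The square itself is a cocone whose first leg lies over an identity.\<close>
  have square: "?e \<cdot>\<^bsub>X\<^esub> farr D v = \<psi> \<cdot>\<^bsub>X\<^esub> eps X B \<Phi> D K Z \<longleftrightarrow> farr \<Phi> \<psi> = v"
    using cocone_iff[OF e(1) \<psi>] e(2) P.B.comp_id_left[OF v] by simp
  show ?thesis
  proof
    assume ?cocart
    then have cc: "cocartesian X B \<Phi> \<psi>" and \<psi>v: "farr \<Phi> \<psi> = v"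
      by (auto simp: cocartesian_lifting_def)
    have "\<exists>!h. h \<in> hom X Y x \<and> h \<cdot>\<^bsub>X\<^esub> ?e = s \<and> h \<cdot>\<^bsub>X\<^esub> \<psi> = t"
      if s: "s \<in> hom X (fobj D J) x" and t: "t \<in> hom X Z x"
        and st: "s \<cdot>\<^bsub>X\<^esub> farr D v = t \<cdot>\<^bsub>X\<^esub> eps X B \<Phi> D K Z" for x s t
    proof -
      have u: "farr \<Phi> s \<in> hom B (fobj \<Phi> Y) (fobj \<Phi> x)"
        using P.farr_hom[OF s] fobj_D[OF S(2)] YX by simp
      have "farr \<Phi> t = farr \<Phi> s \<cdot>\<^bsub>B\<^esub> farr \<Phi> \<psi>" using st cocone_iff[OF s t] \<psi>v by simp
      from cocartesian_factor[OF cc \<psi> t u this]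
      show ?thesis using through_e[OF _ s] by (smt (verit))
    qed
    then show ?pushout
      using square \<psi>v homD[OF S(5)] homD[OF S(6)] homD[OF e(1)] homD[OF \<psi>]
      unfolding is_pushout_def by simp
  next
    assume po: ?pushout
    then have \<psi>v: "farr \<Phi> \<psi> = v" using square by (simp add: is_pushout_def)
    have "\<exists>!\<phi>. \<phi> \<in> hom X Y x \<and> farr \<Phi> \<phi> = u \<and> t = \<phi> \<cdot>\<^bsub>X\<^esub> \<psi>"
      if u: "u \<in> hom B J (fobj \<Phi> x)" and t: "t \<in> hom X Z x" and tu: "farr \<Phi> t = u \<cdot>\<^bsub>B\<^esub> v"
      for x u t
    proof -
      \<comment> \<open>The missing leg of the cocone is the transpose of \<open>u\<close>.\<close>
      obtain s where s: "s \<in> hom X (fobj D J) x" "farr \<Phi> s = u"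
        using arrow_from_D_exists[OF u] hom_objs[OF t] by blast
      have "s \<cdot>\<^bsub>X\<^esub> farr D v = t \<cdot>\<^bsub>X\<^esub> eps X B \<Phi> D K Z"
        using cocone_iff[OF s(1) t] s(2) tu by simp
      then have "\<exists>!h. h \<in> hom X Y x \<and> h \<cdot>\<^bsub>X\<^esub> ?e = s \<and> h \<cdot>\<^bsub>X\<^esub> \<psi> = t"
        using pushout_factor[OF po S(5,6) e(1) s(1) t] by simp
      then show ?thesis using through_e[OF _ s(1)] s(2) by (smt (verit))
    qed
    then show ?cocart
      using homD[OF \<psi>] \<psi>v YX unfolding cocartesian_lifting_def cocartesian_def
      by (simp add: hom_def)
  qed
qed

text \<open>An arbitrary pushout with vertex \<open>W\<close> is replaced by an isomorphic one over
  \<open>J\<close>: the cartesian arrow \<phi> into \<open>W\<close> turns out to be inverse to the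
  comparison arrow \<open>h\<close>.\<close>

lemma pushout_in_fibre:
  assumes fib: "fibration X B \<Phi>" and "has_pushouts X"
  obtains Y \<psi> where "Y \<in> Obj (fibre X B \<Phi> J)" and "\<psi> \<in> hom X Z Y"
    and "is_pushout X (farr D v) (eps X B \<Phi> D K Z) (eps X B \<Phi> D J Y) \<psi>"
proof -
  note S = source_facts
  obtain p q where po: "is_pushout X (farr D v) (eps X B \<Phi> D K Z) p q"
    using assms(2) homD[OF S(5)] homD[OF S(6)] unfolding has_pushouts_def by metis
  define W where "W = Cod X p"
  have p: "p \<in> hom X (fobj D J) W" and q: "q \<in> hom X Z W"
    and comm: "p \<cdot>\<^bsub>X\<^esub> farr D v = q \<cdot>\<^bsub>X\<^esub> eps X B \<Phi> D K Z"
    using po homD[OF S(5)] homD[OF S(6)] by (auto simp: is_pushout_def hom_def W_def)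
  \<comment> \<open>The transpose of \<open>p\<close>; lifting it to a cartesian arrow into
    \<open>W\<close> yields an object over \<open>J\<close>.\<close>
  define w where "w = farr \<Phi> p"
  have w: "w \<in> hom B J (fobj \<Phi> W)"
    using P.farr_hom[OF p] fobj_D[OF S(2)] by (simp add: w_def)
  have qw: "farr \<Phi> q = w \<cdot>\<^bsub>B\<^esub> v" using cocone_iff[OF p q] comm by (simp add: w_def)
  have W: "W \<in> Obj X" using hom_objs[OF p] by simp
  obtain \<phi> where cart: "cartesian X B \<Phi> \<phi>" and \<phi>w: "farr \<Phi> \<phi> = w" and "Cod X \<phi> = W"
    using fib homD[OF w] W unfolding fibration_def by metis
  define Y where "Y = Dom X \<phi>"
  have \<phi>: "\<phi> \<in> hom X Y W"
    using cart \<open>Cod X \<phi> = W\<close> by (simp add: hom_def cartesian_def Y_def)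
  have YJ: "fobj \<Phi> Y = J" using homD[OF P.farr_hom[OF \<phi>]] homD[OF w] \<phi>w by simp
  have Y: "Y \<in> Obj (fibre X B \<Phi> J)" using hom_objs[OF \<phi>] YJ by (simp add: fibre_def)
  let ?e = "eps X B \<Phi> D J Y"
  have e: "?e \<in> hom X (fobj D J) Y" "farr \<Phi> ?e = Idt B J" using eps_arrow[OF S(2) Y] .
  \<comment> \<open>As \<open>q\<close> lies over \<open>w\<close> after \<open>v\<close>, it
    factors through \<phi> by an arrow over \<open>v\<close>.\<close>
  obtain \<psi> where \<psi>: "\<psi> \<in> hom X Z Y" "farr \<Phi> \<psi> = v" "q = \<phi> \<cdot>\<^bsub>X\<^esub> \<psi>"
    using cartesian_factor[OF cart \<phi> q] v S(4) YJ qw \<phi>w by (metis (no_types, lifting))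
  have \<phi>e: "\<phi> \<cdot>\<^bsub>X\<^esub> ?e = p"
    using arrows_from_D_eqI[OF P.A.comp_hom[OF e(1) \<phi>] p S(2)]
      farr_comp_over_id[OF e(1) _ \<phi>] e(2) YJ \<phi>w w_def by simp
  have "?e \<cdot>\<^bsub>X\<^esub> farr D v = \<psi> \<cdot>\<^bsub>X\<^esub> eps X B \<Phi> D K Z"
    using cocone_iff[OF e(1) \<psi>(1)] e(2) \<psi>(2) P.B.comp_id_left[OF v] by simp
  then obtain h where h: "h \<in> hom X W Y" "h \<cdot>\<^bsub>X\<^esub> p = ?e" "h \<cdot>\<^bsub>X\<^esub> q = \<psi>"
    using pushout_factor[OF po S(5,6) p e(1) \<psi>(1)] by blast
  \<comment> \<open>Both sides are endomorphisms of \<open>W\<close> fixing the two legs of the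
    pushout.\<close>
  have \<phi>h: "\<phi> \<cdot>\<^bsub>X\<^esub> h = Idt X W"
  proof -
    have "\<exists>!k. k \<in> hom X W W \<and> k \<cdot>\<^bsub>X\<^esub> p = p \<and> k \<cdot>\<^bsub>X\<^esub> q = q"
      using pushout_factor[OF po S(5,6) p p q comm] .
    moreover have "\<phi> \<cdot>\<^bsub>X\<^esub> h \<in> hom X W W" using P.A.comp_hom[OF h(1) \<phi>] .
    moreover have "(\<phi> \<cdot>\<^bsub>X\<^esub> h) \<cdot>\<^bsub>X\<^esub> p = p" using P.A.comp_assoc[OF p h(1) \<phi>] h(2) \<phi>e by simp
    moreover have "(\<phi> \<cdot>\<^bsub>X\<^esub> h) \<cdot>\<^bsub>X\<^esub> q = q" using P.A.comp_assoc[OF q h(1) \<phi>] h(3) \<psi>(3) by simp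
    ultimately show ?thesis
      using P.A.id_hom[OF W] P.A.comp_id_left[OF p] P.A.comp_id_left[OF q] by blast
  qed
  have h\<phi>: "h \<cdot>\<^bsub>X\<^esub> \<phi> = Idt X Y"
  proof -
    have hphi: "h \<cdot>\<^bsub>X\<^esub> \<phi> \<in> hom X Y Y" using P.A.comp_hom[OF \<phi> h(1)] .
    have YX: "Y \<in> Obj X" using hom_objs[OF \<phi>] by simp
    have "farr \<Phi> (h \<cdot>\<^bsub>X\<^esub> \<phi>) = farr \<Phi> h \<cdot>\<^bsub>B\<^esub> w" using P.farr_comp[OF \<phi> h(1)] \<phi>w by simp
    \<comment> \<open>Since \<open>w\<close> is the image of \<open>p\<close>, the left side is the
      image of \<open>h\<close> after \<open>p\<close>, which is \<open>?e\<close>. Uniqueness for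
      \<phi> compares only factorisations with equal image, so this must come first.\<close>
    also have "\<dots> = Idt B J" using P.farr_comp[OF p h(1)] h(2) e(2) w_def by simp
    finally have over: "farr \<Phi> (h \<cdot>\<^bsub>X\<^esub> \<phi>) = Idt B J" .
    have "\<phi> \<cdot>\<^bsub>X\<^esub> (h \<cdot>\<^bsub>X\<^esub> \<phi>) = \<phi>"
      using P.A.comp_assoc[OF \<phi> h(1) \<phi>] \<phi>h P.A.comp_id_left[OF \<phi>] by simp
    \<comment> \<open>Both \<open>h\<close> after \<phi> and the identity of \<open>Y\<close> factor
      \<phi> through itself over the identity of \<open>J\<close>.\<close>
    moreover have "\<exists>!k. k \<in> hom X Y Y \<and> farr \<Phi> k = Idt B J \<and> \<phi> = \<phi> \<cdot>\<^bsub>X\<^esub> k"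
      using cartesian_factor[OF cart \<phi> \<phi>, of "Idt B J"] P.B.id_hom[OF S(2)] YJ \<phi>w
        P.B.comp_id_right[OF w] by simp
    ultimately show ?thesis
      using hphi over P.A.id_hom[OF YX] P.farr_id[OF YX] YJ P.A.comp_id_right[OF \<phi>] by metis
  qed
  \<comment> \<open>Transport along \<open>h\<close> turns the legs \<open>p\<close> and
    \<open>q\<close> into \<open>?e\<close> and \<psi>.\<close>
  have "is_pushout X (farr D v) (eps X B \<Phi> D K Z) ?e \<psi>"
    using P.A.pushout_iso[OF po, of h Y \<phi>] h \<phi> \<phi>h h\<phi> by (simp add: W_def)
  then show thesis using that Y \<psi>(1) by blast
qed

end

end

text \<open>The equivalence alone would not say that a lifting exists; the second conjunct supplies
  one, by moving a pushout of the span into the fibre over \<open>J\<close>.\<close>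

theorem theorem4p2:
  fixes X :: "('o, 'm) cat" and B :: "('p, 'n) cat"
    and \<Phi> :: "('o, 'm, 'p, 'n) func" and D :: "('p, 'n, 'o, 'm) func" and \<eta> :: "'p \<Rightarrow> 'n"
  assumes "fibration X B \<Phi>"
    and "left_adjoint X B D \<Phi> \<eta>"
    and "\<And>I. I \<in> Obj B \<Longrightarrow> \<eta> I = Idt B I"
    and "has_pushouts X"
    and "v \<in> hom B K J"
    and "Z \<in> Obj (fibre X B \<Phi> K)"
  shows "(\<forall>Y \<in> Obj (fibre X B \<Phi> J). \<forall>\<psi> \<in> hom X Z Y.
      cocartesian_lifting X B \<Phi> Z v \<psi> \<longleftrightarrow>
      is_pushout X (farr D v) (eps X B \<Phi> D K Z) (eps X B \<Phi> D J Y) \<psi>) \<and>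
    (\<exists>Y \<in> Obj (fibre X B \<Phi> J). \<exists>\<psi> \<in> hom X Z Y.
      cocartesian_lifting X B \<Phi> Z v \<psi> \<and>
      is_pushout X (farr D v) (eps X B \<Phi> D K Z) (eps X B \<Phi> D J Y) \<psi>)"
proof -
  interpret identity_unit_adjunction X B \<Phi> D \<eta>
    using assms(2,3) by unfold_locales
  show ?thesis
    using cocartesian_lifting_iff_pushout[OF assms(5,6)]
      pushout_in_fibre[OF assms(5,6,1,4)] by metis
qed

end
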